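(* Let $G$ be a finitely generated infinite group of linear volume growth. Then $G$ contains a cyclic subgroup of finite index.
   Context: A finitely generated group $G$ has linear volume growth if some (and hence every) Cayley graph of $G$ with respect to a finite generating set has linear volume growth, meaning that the balls about a fixed vertex $o$ (in the graph metric) grow at most linearly in the radius: there is a constant $C$ such that the ball of radius $r$ about $o$ has at most $C r$ elements for every integer $r \ge 1$. *)

theory Defs
  imports
    "HOL-Algebra.Elementary_Groups"
    "Graph_Theory.Shortest_Path"
begin

context wf_digraph
begin

text \<open>
  Distances come from the shortest-path function of the library with every arc of weight 1.
  Its value is infinite for unreachable vertices, so these never belong to a ball.
\<close>
definition graph_dist :: "'a \<Rightarrow> 'a \<Rightarrow> ereal" where
  "graph_dist u v = \<mu> (\<lambda>_. 1) u v"

definition graph_ball :: "'a \<Rightarrow> nat \<Rightarrow> 'a set" where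
  "graph_ball u r = {v \<in> verts G. graph_dist u v \<le> ereal (real r)}"

text \<open>
  Finiteness of the balls is demanded explicitly because \<^const>\<open>card\<close> is 0 on infinite sets.
  In a connected undirected graph the choice of the centre is immaterial.
\<close>
definition linear_volume_growth :: bool where
  "linear_volume_growth \<longleftrightarrow>
     (\<exists>u \<in> verts G. \<exists>C::real. \<forall>r::nat. r \<ge> 1 \<longrightarrow>
        finite (graph_ball u r) \<and> real (card (graph_ball u r)) \<le> C * real r)"

lemma awalk_cost_unit: "awalk_cost (\<lambda>_. 1) p = real (length p)"
  by (induction p) auto

lemma graph_dist_le_iff:
  "graph_dist u v \<le> ereal (real r) \<longleftrightarrow> (\<exists>p. awalk u p v \<and> length p \<le> r)"
proof
  assume le: "graph_dist u v \<le> ereal (real r)"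
  show "\<exists>p. awalk u p v \<and> length p \<le> r"
  proof (rule ccontr)
    assume none: "\<nexists>p. awalk u p v \<and> length p \<le> r"
    have "ereal (real r + 1) \<le> graph_dist u v"
      unfolding graph_dist_def \<mu>_def
    proof (rule INF_greatest)
      fix p assume "p \<in> {p. awalk u p v}"
      with none have "Suc r \<le> length p" by (auto simp: not_le Suc_le_eq)
      then show "ereal (real r + 1) \<le> ereal (awalk_cost (\<lambda>_. 1) p)"
        by (simp add: awalk_cost_unit)
    qed
    with le have "ereal (real r + 1) \<le> ereal (real r)" by (rule order_trans[rotated])
    then show False by simp
  qed
next
  assume "\<exists>p. awalk u p v \<and> length p \<le> r"
  then obtain p where p: "awalk u p v" "length p \<le> r" by blast
  have "graph_dist u v \<le> ereal (real (length p))"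
    using min_cost_le_walk_cost[OF p(1), of "\<lambda>_. 1"]
    by (simp add: graph_dist_def awalk_cost_unit)
  also have "\<dots> \<le> ereal (real r)" using p(2) by simp
  finally show "graph_dist u v \<le> ereal (real r)" .
qed

end

definition finite_generating_set :: "('a, 'b) monoid_scheme \<Rightarrow> 'a set \<Rightarrow> bool" where
  "finite_generating_set G S \<longleftrightarrow> finite S \<and> S \<subseteq> carrier G \<and> generate G S = carrier G"

definition finitely_generated_group :: "('a, 'b) monoid_scheme \<Rightarrow> bool" where
  "finitely_generated_group G \<longleftrightarrow> group G \<and> (\<exists>S. finite_generating_set G S)"

text \<open>
  The right Cayley graph. The generating set need not be closed under inverses, so both
  orientations of every edge are included: an undirected edge is a pair of opposite arcs.
  If the generating set contains the identity there are loops, which do not affect distances.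
\<close>
definition cayley_graph :: "('a, 'b) monoid_scheme \<Rightarrow> 'a set \<Rightarrow> ('a, 'a \<times> 'a) pre_digraph" where
  "cayley_graph G S =
     \<lparr> verts = carrier G,
       arcs = {(x, y). x \<in> carrier G \<and> y \<in> carrier G \<and>
                 (\<exists>s \<in> S. y = x \<otimes>\<^bsub>G\<^esub> s \<or> x = y \<otimes>\<^bsub>G\<^esub> s)},
       tail = fst,
       head = snd \<rparr>"

lemma sym_digraph_cayley_graph: "sym_digraph (cayley_graph G S)"
  by unfold_locales (auto simp: cayley_graph_def symmetric_conv)

lemma wf_digraph_cayley_graph: "wf_digraph (cayley_graph G S)"
  using sym_digraph_cayley_graph by (rule sym_digraph.axioms)

definition group_linear_volume_growth :: "('a, 'b) monoid_scheme \<Rightarrow> bool" where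
  "group_linear_volume_growth G \<longleftrightarrow>
     (\<exists>S. finite_generating_set G S \<and> wf_digraph.linear_volume_growth (cayley_graph G S))"

end

theory Submission
  imports Defs
begin

text \<open>
  Two separate facts combine: an infinite group of linear growth has an element of infinite
  order, and the cyclic subgroup generated by any such element has finite index.

  For the first (\<open>exists_infinite_order\<close>), compactness gives a geodesic ray
  \<open>x 0, x 1, x 2, \<dots>\<close> in the Cayley graph. Linear growth forces the spheres to have at
  most some fixed number \<open>K\<close> of elements for infinitely many radii \<open>n\<close>. For such
  an \<open>n\<close> two of the \<open>K + 1\<close> group elements
  \<open>(x i)\<inverse> (x (i + n))\<close>, \<open>i \<le> K\<close>, coincide, and one pair \<open>i < j\<close>
  serves infinitely many \<open>n\<close>. Then \<open>g = (x j) (x i)\<inverse>\<close> carries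
  \<open>x (i + n)\<close> to \<open>x (j + n)\<close> for infinitely many \<open>n\<close>, so left
  multiplication by \<open>g\<close> lowers the Busemann function of the ray, the limit of
  \<open>d(y, x n) - n\<close>, by exactly \<open>j - i\<close> at every point \<open>y\<close>. Hence the powers of
  \<open>g\<close> take pairwise different values of this function and \<open>g\<close> has infinite order.

  For the second (\<open>finite_index_of_infinite_order\<close>), if the subgroup \<open>H\<close> generated
  by \<open>g\<close> had infinitely many cosets, there would be for every \<open>i\<close> an element
  \<open>y i\<close> of length \<open>i\<close> that is shortest in its coset. The products
  \<open>g\<^sup>k (y i)\<close> with \<open>k, i \<le> r\<close> would be \<open>(r + 1)\<^sup>2\<close> distinct elements in a ball
  whose radius is linear in \<open>r\<close>.
\<close>

section \<open>Length functions in which elements split along geodesics\<close>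

text \<open>
  These are the only properties of a word length that the argument needs. The last one says
  that every element is joined to the identity by a geodesic path. The distance from \<open>y\<close> to
  \<open>z\<close> is \<open>len (inv y \<otimes> z)\<close>, which is invariant under left multiplication.
\<close>
locale geodesic_length = group G for G (structure) +
  fixes len :: "'a \<Rightarrow> nat"
  assumes finite_ball: "finite {x \<in> carrier G. len x \<le> r}"
    and len_one: "len \<one> = 0"
    and len_eq_0: "\<lbrakk>x \<in> carrier G; len x = 0\<rbrakk> \<Longrightarrow> x = \<one>"
    and len_mult: "\<lbrakk>x \<in> carrier G; y \<in> carrier G\<rbrakk> \<Longrightarrow> len (x \<otimes> y) \<le> len x + len y"
    and len_split: "\<lbrakk>x \<in> carrier G; k \<le> len x\<rbrakk> \<Longrightarrow>
      \<exists>y\<in>carrier G. \<exists>z\<in>carrier G. x = y \<otimes> z \<and> len y = k \<and> len z = len x - k"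
begin

lemma len_triangle:
  assumes "x \<in> carrier G" "y \<in> carrier G" "z \<in> carrier G"
  shows "len (inv x \<otimes> z) \<le> len (inv x \<otimes> y) + len (inv y \<otimes> z)"
proof -
  have "inv x \<otimes> z = (inv x \<otimes> y) \<otimes> (inv y \<otimes> z)"
    using assms by (metis inv_closed m_assoc m_closed r_inv r_one)
  then show ?thesis using len_mult[of "inv x \<otimes> y" "inv y \<otimes> z"] assms by simp
qed

lemma len_le_dist:
  assumes "y \<in> carrier G" "z \<in> carrier G"
  shows "len z \<le> len y + len (inv y \<otimes> z)"
  using len_triangle[of \<one> y z] assms by simp

lemma dist_mult_left:
  assumes "g \<in> carrier G" "y \<in> carrier G" "z \<in> carrier G"
  shows "inv (g \<otimes> y) \<otimes> (g \<otimes> z) = inv y \<otimes> z"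
proof -
  have "inv g \<otimes> (g \<otimes> z) = z" using assms by (simp add: m_assoc[symmetric])
  then show ?thesis using assms by (simp add: inv_mult_group m_assoc)
qed

lemma len_pow: "g \<in> carrier G \<Longrightarrow> len (g [^] (k::nat)) \<le> k * len g"
proof (induction k)
  case (Suc k)
  then show ?case using len_mult[of "g [^] k" g] by simp
qed (simp add: len_one)

section \<open>A geodesic ray\<close>

definition beyond :: "'a \<Rightarrow> 'a set" where
  "beyond y = {z \<in> carrier G. len z = len y + len (inv y \<otimes> z)}"

text \<open>
  The elements that have a geodesic from the identity through \<open>y\<close> fall, apart from
  \<open>y\<close> itself, into finitely many classes according to the next vertex of that geodesic;
  if there are infinitely many of them, one class is infinite.
\<close>
lemma infinite_beyond_step:
  assumes y: "y \<in> carrier G" and inf: "infinite (beyond y)"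
  shows "\<exists>y'\<in>carrier G. infinite (beyond y') \<and> len y' = Suc (len y) \<and> len (inv y \<otimes> y') = 1"
proof (rule ccontr)
  assume contr: "\<not> ?thesis"
  let ?S = "{s \<in> carrier G. len s = 1 \<and> len (y \<otimes> s) = Suc (len y)}"
  have "beyond y - {y} \<subseteq> (\<Union>s\<in>?S. beyond (y \<otimes> s))"
  proof
    fix z assume z: "z \<in> beyond y - {y}"
    then have zc: "z \<in> carrier G" and lz: "len z = len y + len (inv y \<otimes> z)"
      by (auto simp: beyond_def)
    have "inv y \<otimes> z \<noteq> \<one>"
      using z zc y by (metis DiffD2 inv_closed inv_equality inv_inv singletonI)
    then have "1 \<le> len (inv y \<otimes> z)"
      using len_eq_0[of "inv y \<otimes> z"] y zc by (metis One_nat_def Suc_leI inv_closed m_closed neq0_conv)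
    then obtain s w where sw: "s \<in> carrier G" "w \<in> carrier G" "inv y \<otimes> z = s \<otimes> w"
        "len s = 1" "len w = len (inv y \<otimes> z) - 1"
      using len_split[of "inv y \<otimes> z" 1] y zc by auto
    have "inv (y \<otimes> s) \<otimes> z = inv s \<otimes> (inv y \<otimes> z)"
      using y zc sw(1) by (simp add: inv_mult_group m_assoc)
    also have "\<dots> = w" using sw(1,2) unfolding sw(3) by (simp add: m_assoc[symmetric])
    finally have w: "inv (y \<otimes> s) \<otimes> z = w" .
    have "len z \<le> len (y \<otimes> s) + len w"
      using len_le_dist[of "y \<otimes> s" z] y zc sw(1) w by simp
    moreover have "len (y \<otimes> s) \<le> Suc (len y)" using len_mult[OF y sw(1)] sw(4) by simp
    ultimately have "len (y \<otimes> s) = Suc (len y)" "len z = len (y \<otimes> s) + len w"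
      using lz sw(5) \<open>1 \<le> len (inv y \<otimes> z)\<close> by auto
    then show "z \<in> (\<Union>s\<in>?S. beyond (y \<otimes> s))"
      using sw(1,4) zc w unfolding beyond_def by auto
  qed
  moreover have "finite ?S" by (rule finite_subset[OF _ finite_ball[of 1]]) auto
  moreover have "finite (beyond (y \<otimes> s))" if "s \<in> ?S" for s
  proof (rule ccontr)
    assume "infinite (beyond (y \<otimes> s))"
    moreover have "inv y \<otimes> (y \<otimes> s) = s" using y that by (simp add: m_assoc[symmetric])
    ultimately show False using contr that y by auto
  qed
  ultimately have "finite (beyond y - {y})" by (meson finite_UN_I finite_subset)
  then show False using inf by simp
qed

lemma exists_geodesic_ray:
  assumes "infinite (carrier G)"
  obtains x :: "nat \<Rightarrow> 'a"
  where "\<And>n. x n \<in> carrier G" "\<And>n. len (x n) = n" "\<And>i n. len (inv (x i) \<otimes> x (i + n)) = n"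
proof -
  let ?P = "\<lambda>n y. y \<in> carrier G \<and> len y = n \<and> infinite (beyond y)"
  have "beyond \<one> = carrier G" by (auto simp: beyond_def len_one)
  then have "?P 0 \<one>" using assms by (simp add: len_one)
  moreover have "\<exists>y'. ?P (Suc n) y' \<and> len (inv y \<otimes> y') = 1" if "?P n y" for n y
    using infinite_beyond_step[of y] that by auto
  ultimately obtain x where P: "\<And>n. ?P n (x n)" and step: "\<And>n. len (inv (x n) \<otimes> x (Suc n)) = 1"
    using dependent_nat_choice[of ?P "\<lambda>_ y y'. len (inv y \<otimes> y') = 1"] by metis
  have le: "len (inv (x i) \<otimes> x (i + n)) \<le> n" for i n
  proof (induction n)
    case 0
    then show ?case using P[of i] by (simp add: len_one)
  next
    case (Suc n)
    then show ?case
      using len_triangle[of "x i" "x (i + n)" "x (Suc (i + n))"] P step[of "i + n"] by auto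
  qed
  have "len (inv (x i) \<otimes> x (i + n)) = n" for i n
    using le[of i n] len_le_dist[of "x i" "x (i + n)"] P[of i] P[of "i + n"] by linarith
  with that[of x] P show thesis by auto
qed

section \<open>The Busemann function of a ray\<close>

text \<open>
  By the triangle inequality the integers \<open>d(y, x n) - n\<close> decrease with \<open>n\<close> and are at
  least \<open>- len y\<close>, so they become constant.
\<close>
lemma busemann_limit:
  assumes x: "\<And>n. x n \<in> carrier G" "\<And>n. len (x n) = n" "\<And>i n. len (inv (x i) \<otimes> x (i + n)) = n"
    and y: "y \<in> carrier G"
  shows "\<exists>b::int. \<exists>N::nat. \<forall>n\<ge>N. int (len (inv y \<otimes> x n)) - int n = b"
proof -
  \<comment> \<open>Adding \<open>len y\<close> makes the sequence natural-valued, so a least value exists.\<close>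
  define f where "f n = len y + len (inv y \<otimes> x n) - n" for n
  have lower: "n \<le> len y + len (inv y \<otimes> x n)" for n
    using len_le_dist[OF y x(1)[of n]] x(2)[of n] by simp
  have dec: "f m \<le> f n" if "n \<le> m" for n m
    using len_triangle[OF y x(1)[of n] x(1)[of m]] x(3)[of n "m - n"] that
    by (simp add: f_def)
  define N where "N = (ARG_MIN f n. True)"
  have "f N \<le> f n" for n unfolding N_def by (rule arg_min_nat_le) simp
  then have "f n = f N" if "n \<ge> N" for n using dec[OF that] by (simp add: le_antisym)
  then have "int (len (inv y \<otimes> x n)) - int n = int (f N) - int (len y)" if "n \<ge> N" for n
    using that lower[of n] by (smt (verit, best) f_def int_ops(6) of_nat_add of_nat_mono)
  then show ?thesis by blast
qed

text \<open>
  An element that sends infinitely many points of a geodesic ray further along it by the same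
  amount behaves like a translation along the ray: it lowers the Busemann function by that
  amount everywhere.
\<close>
lemma inj_pow_of_ray_shift:
  assumes x: "\<And>n. x n \<in> carrier G" "\<And>n. len (x n) = n" "\<And>i n. len (inv (x i) \<otimes> x (i + n)) = n"
    and g: "g \<in> carrier G" and ij: "i < j"
    and shift: "infinite {n. g \<otimes> x (i + n) = x (j + n)}"
  shows "inj (\<lambda>k::nat. g [^] k)"
proof -
  obtain b N where b: "\<And>y n. y \<in> carrier G \<Longrightarrow> n \<ge> N y \<Longrightarrow> int (len (inv y \<otimes> x n)) - int n = b y"
    using busemann_limit[OF x] by metis
  have drop: "b (g \<otimes> y) = b y - (int j - int i)" if y: "y \<in> carrier G" for y
  proof -
    obtain n where n: "n \<ge> N y + N (g \<otimes> y)" "g \<otimes> x (i + n) = x (j + n)"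
      using shift unfolding infinite_nat_iff_unbounded_le by blast
    have "inv (g \<otimes> y) \<otimes> x (j + n) = inv y \<otimes> x (i + n)"
      using dist_mult_left[OF g y x(1)[of "i + n"]] n(2) by simp
    moreover have "int (len (inv (g \<otimes> y) \<otimes> x (j + n))) - int (j + n) = b (g \<otimes> y)"
      using b[of "g \<otimes> y" "j + n"] g y n(1) by simp
    moreover have "int (len (inv y \<otimes> x (i + n))) - int (i + n) = b y"
      using b[of y "i + n"] y n(1) by simp
    ultimately show ?thesis by simp
  qed
  have pow: "b (g [^] k) = b \<one> - int k * (int j - int i)" for k :: nat
  proof (induction k)
    case (Suc k)
    have "g [^] Suc k = g \<otimes> g [^] k" using g by (rule nat_pow_Suc2)
    then show ?case using drop[of "g [^] k"] g Suc by (simp add: algebra_simps)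
  qed simp
  show ?thesis
  proof (rule injI)
    fix k l :: nat assume "g [^] k = g [^] l"
    then have "int k * (int j - int i) = int l * (int j - int i)" using pow[of k] pow[of l]
      by (metis add_left_cancel diff_add_cancel)
    then show "k = l" using ij by simp
  qed
qed

section \<open>Linear growth yields an element of infinite order\<close>

text \<open>
  If all but finitely many spheres had more than \<open>K \<ge> C\<close> elements, the balls would grow with
  slope at least \<open>K + 1 > C\<close>.
\<close>
lemma frequently_bounded_spheres:
  fixes C :: real
  assumes growth: "\<And>r. r \<ge> 1 \<Longrightarrow> real (card {x \<in> carrier G. len x \<le> r}) \<le> C * real r"
  shows "\<exists>K. infinite {n. card {x \<in> carrier G. len x = n} \<le> K}"
proof (rule ccontr)
  define K where "K = nat \<lceil>C\<rceil>"
  assume "\<not> ?thesis"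
  then have "finite {n. card {x \<in> carrier G. len x = n} \<le> K}" by blast
  then obtain N where "\<forall>n\<in>{n. card {x \<in> carrier G. len x = n} \<le> K}. n \<le> N"
    unfolding finite_nat_set_iff_bounded_le by (rule exE)
  then have N: "card {x \<in> carrier G. len x = n} > K" if "n > N" for n
    using that by (simp add: linorder_not_le[symmetric]) blast
  have many: "card {x \<in> carrier G. len x \<le> N + m} \<ge> m * Suc K" for m
  proof (induction m)
    case (Suc m)
    have "{x \<in> carrier G. len x \<le> N + Suc m}
        = {x \<in> carrier G. len x \<le> N + m} \<union> {x \<in> carrier G. len x = N + Suc m}" by auto
    moreover have "finite {x \<in> carrier G. len x = N + Suc m}"
      by (rule finite_subset[OF _ finite_ball[of "N + Suc m"]]) auto
    ultimately have "card {x \<in> carrier G. len x \<le> N + Suc m}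
        = card {x \<in> carrier G. len x \<le> N + m} + card {x \<in> carrier G. len x = N + Suc m}"
      by (simp add: finite_ball card_Un_disjoint disjoint_iff)
    then show ?case using Suc N[of "N + Suc m"] by simp
  qed simp
  define m where "m = Suc (nat \<lceil>C * real N\<rceil>)"
  have "real m > C * real N" unfolding m_def by linarith
  moreover have "real m * (real K + 1) \<le> C * (real N + real m)"
  proof -
    have "real (m * Suc K) \<le> real (card {x \<in> carrier G. len x \<le> N + m})"
      using many[of m] by (simp only: of_nat_le_iff)
    also have "\<dots> \<le> C * real (N + m)" using growth[of "N + m"] by (simp add: m_def)
    finally show ?thesis by (simp add: algebra_simps)
  qed
  moreover have "C * real m \<le> real K * real m"
    unfolding K_def by (intro mult_right_mono) linarith+
  ultimately show False by (simp add: algebra_simps)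
qed

lemma exists_infinite_order:
  fixes C :: real
  assumes inf: "infinite (carrier G)"
    and growth: "\<And>r. r \<ge> 1 \<Longrightarrow> real (card {x \<in> carrier G. len x \<le> r}) \<le> C * real r"
  shows "\<exists>g\<in>carrier G. inj (\<lambda>k::nat. g [^] k)"
proof -
  obtain x where x: "\<And>n. x n \<in> carrier G" "\<And>n. len (x n) = n"
      "\<And>i n. len (inv (x i) \<otimes> x (i + n)) = n"
    using exists_geodesic_ray[OF inf] by blast
  obtain K where K: "infinite {n. card {x \<in> carrier G. len x = n} \<le> K}"
    using frequently_bounded_spheres[OF growth] by blast
  \<comment> \<open>\<open>R n (i, j)\<close>: the left translation that takes \<open>x i\<close> to \<open>x j\<close> also takes
    \<open>x (i + n)\<close> to \<open>x (j + n)\<close>.\<close>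
  define R where "R n p \<longleftrightarrow> inv (x (fst p)) \<otimes> x (fst p + n) = inv (x (snd p)) \<otimes> x (snd p + n)"
    for n p
  let ?pairs = "{p \<in> {..K} \<times> {..K}. fst p < snd p}"
  have "\<exists>p\<in>?pairs. R n p" if n: "card {x \<in> carrier G. len x = n} \<le> K" for n
  proof -
    let ?h = "\<lambda>i. inv (x i) \<otimes> x (i + n)"
    have "?h ` {..K} \<subseteq> {x \<in> carrier G. len x = n}" using x by auto
    moreover have "finite {x \<in> carrier G. len x = n}"
      by (rule finite_subset[OF _ finite_ball[of n]]) auto
    ultimately have "card (?h ` {..K}) \<le> card {x \<in> carrier G. len x = n}"
      by (rule card_mono[rotated])
    with n have "card (?h ` {..K}) \<le> K" by (rule order_trans[rotated])
    then have "\<not> inj_on ?h {..K}" using card_image[of ?h "{..K}"] by auto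
    then obtain i j where "i \<le> K" "j \<le> K" "i \<noteq> j" "?h i = ?h j" by (auto simp: inj_on_def)
    then have "(i, j) \<in> ?pairs \<and> R n (i, j) \<or> (j, i) \<in> ?pairs \<and> R n (j, i)"
      unfolding R_def by auto
    then show ?thesis by blast
  qed
  then have "\<forall>n\<in>{n. card {x \<in> carrier G. len x = n} \<le> K}. \<exists>p\<in>?pairs. R n p" by blast
  moreover have "finite ?pairs" by (rule finite_subset[of _ "{..K} \<times> {..K}"]) auto
  ultimately obtain p where p: "p \<in> ?pairs"
    and p_inf: "infinite {n \<in> {n. card {x \<in> carrier G. len x = n} \<le> K}. R n p}"
    using pigeonhole_infinite_rel[OF K] by blast
  have Rinf: "infinite {n. R n p}" by (rule infinite_super[OF _ p_inf]) blast
  define g where "g = x (snd p) \<otimes> inv (x (fst p))"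
  have g: "g \<in> carrier G" unfolding g_def using x by simp
  have "g \<otimes> x (fst p + n) = x (snd p + n)" if "R n p" for n
  proof -
    have "g \<otimes> x (fst p + n) = x (snd p) \<otimes> (inv (x (snd p)) \<otimes> x (snd p + n))"
      using that x(1) unfolding g_def R_def by (simp add: m_assoc)
    then show ?thesis using x(1) by (simp add: m_assoc[symmetric])
  qed
  then have "{n. R n p} \<subseteq> {n. g \<otimes> x (fst p + n) = x (snd p + n)}" by blast
  then have "infinite {n. g \<otimes> x (fst p + n) = x (snd p + n)}"
    using Rinf infinite_super by blast
  then show ?thesis using inj_pow_of_ray_shift[OF x g, of "fst p" "snd p"] p g by auto
qed

section \<open>Linear growth forces finite index\<close>

text \<open>
  Since balls are finite, infinitely many cosets cannot all meet one ball, so some coset has a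
  shortest element \<open>z\<close> of length at least \<open>i\<close>. The initial part of length \<open>i\<close> of a
  geodesic to \<open>z\<close> is again shortest in its coset: a shorter representative would shorten
  \<open>z\<close>.
\<close>
lemma exists_shortest_in_coset:
  assumes H: "subgroup H G" and inf: "infinite (rcosets H)"
  shows "\<exists>y\<in>carrier G. len y = i \<and> (\<forall>h\<in>H. i \<le> len (h \<otimes> y))"
proof -
  interpret H: subgroup H G by fact
  have "\<not> rcosets H \<subseteq> (\<lambda>a. H #> a) ` {a \<in> carrier G. len a \<le> i}"
    using inf finite_surj[OF finite_ball[of i]] by blast
  then obtain a where a: "a \<in> carrier G" "H #> a \<notin> (\<lambda>a. H #> a) ` {a \<in> carrier G. len a \<le> i}"
    unfolding RCOSETS_def by blast
  define h0 where "h0 = (ARG_MIN (\<lambda>h. len (h \<otimes> a)) h. h \<in> H)"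
  have h0: "h0 \<in> H" unfolding h0_def by (rule arg_min_natI[of "\<lambda>h. h \<in> H" \<one>]) simp
  have h0_min: "len (h0 \<otimes> a) \<le> len (h \<otimes> a)" if "h \<in> H" for h
    unfolding h0_def using that by (rule arg_min_nat_le)
  define z where "z = h0 \<otimes> a"
  have zc: "z \<in> carrier G" unfolding z_def using h0 a(1) by simp
  have z_min: "len z \<le> len (h \<otimes> z)" if "h \<in> H" for h
    using h0_min[of "h \<otimes> h0"] that h0 a(1) unfolding z_def by (simp add: m_assoc)
  have "z \<in> H #> a" unfolding z_def r_coset_def using h0 by blast
  then have "H #> a = H #> z" using repr_independence[OF _ a(1) H] by blast
  then have "i < len z" using a(2) zc by (metis (mono_tags, lifting) imageI linorder_not_le mem_Collect_eq)
  then obtain y w where yw: "y \<in> carrier G" "w \<in> carrier G" "z = y \<otimes> w" "len y = i"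
      "len w = len z - i"
    using len_split[OF zc, of i] by auto
  have "i \<le> len (h \<otimes> y)" if h: "h \<in> H" for h
  proof -
    have "len z \<le> len (h \<otimes> z)" by (rule z_min[OF h])
    also have "\<dots> \<le> len (h \<otimes> y) + len w"
      using len_mult[of "h \<otimes> y" w] h yw by (simp add: m_assoc)
    finally show ?thesis using yw(5) \<open>i < len z\<close> by simp
  qed
  then show ?thesis using yw by blast
qed

lemma finite_index_of_infinite_order:
  fixes C :: real
  assumes growth: "\<And>r. r \<ge> 1 \<Longrightarrow> real (card {x \<in> carrier G. len x \<le> r}) \<le> C * real r"
    and g: "g \<in> carrier G" and inj: "inj (\<lambda>k::nat. g [^] k)"
  shows "finite (rcosets (generate G {g}))"
proof (rule ccontr)
  let ?H = "generate G {g}"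
  assume "infinite (rcosets ?H)"
  moreover have H: "subgroup ?H G" using g generate_is_subgroup by simp
  ultimately obtain y where y: "\<And>i. y i \<in> carrier G" "\<And>i. len (y i) = i"
      "\<And>i h. h \<in> ?H \<Longrightarrow> i \<le> len (h \<otimes> y i)"
    using exists_shortest_in_coset[of ?H] by metis
  interpret H: subgroup ?H G by fact
  have gH: "g [^] k \<in> ?H" for k :: nat
    by (induction k) (auto intro: generate.intros)
  \<comment> \<open>Both \<open>y i\<close> and \<open>y i'\<close> are shortest in their cosets, so lying in one coset they have
    equal length; this is one of the two symmetric inequalities.\<close>
  have coset_le: "i \<le> i'" if eq: "g [^] (k::nat) \<otimes> y i = g [^] (k'::nat) \<otimes> y i'" for k k' i i'
  proof -
    have "y i' = (inv (g [^] k') \<otimes> g [^] k) \<otimes> y i"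
      using eq y(1) g by (simp add: m_assoc inv_solve_left)
    then show ?thesis
      using y(3)[of "inv (g [^] k') \<otimes> g [^] k" i] y(2)[of i'] gH by simp
  qed
  have inj_prod: "inj (\<lambda>(k::nat, i). g [^] k \<otimes> y i)"
  proof (rule injI, clarify)
    fix k i k' i' assume eq: "g [^] (k::nat) \<otimes> y i = g [^] (k'::nat) \<otimes> y i'"
    then have "i = i'" using coset_le[of k i k' i'] coset_le[of k' i' k i] by simp
    with eq have "g [^] k = g [^] k'" using y(1) g by simp
    with inj have "k = k'" by (auto dest: injD)
    with \<open>i = i'\<close> show "k = k' \<and> i = i'" by simp
  qed
  \<comment> \<open>The products have length at most \<open>r (len g + 1)\<close>, so their number would be at most
    \<open>C (len g + 1) r\<close>; with \<open>r\<close> above \<open>C (len g + 1)\<close> this is below \<open>r\<^sup>2\<close>.\<close>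
  define r where "r = Suc (nat \<lceil>C * real (Suc (len g))\<rceil>)"
  have "(\<lambda>(k::nat, i). g [^] k \<otimes> y i) ` ({..r} \<times> {..r})
      \<subseteq> {x \<in> carrier G. len x \<le> r * Suc (len g)}"
  proof clarsimp
    fix k i assume "k \<le> r" "i \<le> r"
    then have "len (g [^] k \<otimes> y i) \<le> r * len g + r"
      using len_mult[of "g [^] k" "y i"] len_pow[OF g, of k] y(1,2)[of i] g
      by (smt (verit) add_mono le_trans mult_le_mono1 nat_pow_closed)
    then show "g [^] k \<otimes> y i \<in> carrier G \<and> len (g [^] k \<otimes> y i) \<le> r + r * len g"
      using g y(1) by (simp add: add.commute)
  qed
  then have "card ((\<lambda>(k::nat, i). g [^] k \<otimes> y i) ` ({..r} \<times> {..r}))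
      \<le> card {x \<in> carrier G. len x \<le> r * Suc (len g)}"
    by (rule card_mono[OF finite_ball])
  moreover have "card ((\<lambda>(k::nat, i). g [^] k \<otimes> y i) ` ({..r} \<times> {..r})) = Suc r * Suc r"
    by (subst card_image) (auto intro: inj_on_subset[OF inj_prod])
  ultimately have "real (Suc r) * real (Suc r) \<le> real (card {x \<in> carrier G. len x \<le> r * Suc (len g)})"
    by (metis of_nat_le_iff of_nat_mult)
  also have "\<dots> \<le> (C * real (Suc (len g))) * real r"
    using growth[of "r * Suc (len g)"] by (simp only: of_nat_mult mult_ac) (simp add: r_def)
  also have "\<dots> \<le> real r * real r"
    by (rule mult_right_mono) (unfold r_def, linarith+)
  also have "\<dots> < real (Suc r) * real (Suc r)" by (intro mult_strict_mono) auto
  finally show False by simp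
qed

end

section \<open>Word lengths\<close>

definition word_length :: "('a, 'b) monoid_scheme \<Rightarrow> 'a set \<Rightarrow> 'a \<Rightarrow> nat" where
  "word_length G T x = (LEAST n. \<exists>ws. set ws \<subseteq> T \<and> length ws = n \<and> foldr (mult G) ws \<one>\<^bsub>G\<^esub> = x)"

context group
begin

lemma foldr_mult_closed: "set ws \<subseteq> carrier G \<Longrightarrow> foldr (\<otimes>) ws \<one> \<in> carrier G"
  by (induction ws) auto

lemma foldr_mult_append:
  "set us \<subseteq> carrier G \<Longrightarrow> set vs \<subseteq> carrier G \<Longrightarrow>
    foldr (\<otimes>) (us @ vs) \<one> = foldr (\<otimes>) us \<one> \<otimes> foldr (\<otimes>) vs \<one>"
proof (induction us)
  case Nil
  then show ?case by (simp add: foldr_mult_closed)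
next
  case (Cons u us)
  then show ?case
    using foldr_mult_closed[of us] foldr_mult_closed[of vs] by (simp add: m_assoc)
qed

lemma word_length_le:
  "set ws \<subseteq> T \<Longrightarrow> foldr (\<otimes>) ws \<one> = x \<Longrightarrow> word_length G T x \<le> length ws"
  unfolding word_length_def by (rule Least_le) blast

lemma generate_is_word:
  assumes S: "S \<subseteq> carrier G" and x: "x \<in> generate G S"
  shows "\<exists>ws. set ws \<subseteq> S \<union> m_inv G ` S \<and> foldr (\<otimes>) ws \<one> = x"
  using x
proof induction
  case one
  show ?case by (rule exI[of _ "[]"]) simp
next
  case (incl h)
  then show ?case using S by (intro exI[of _ "[h]"]) auto
next
  case (inv h)
  then show ?case using S by (intro exI[of _ "[inv h]"]) auto
next
  case (eng h1 h2)
  then obtain us vs where "set us \<subseteq> S \<union> m_inv G ` S" "foldr (\<otimes>) us \<one> = h1"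
      "set vs \<subseteq> S \<union> m_inv G ` S" "foldr (\<otimes>) vs \<one> = h2" by blast
  moreover have "S \<union> m_inv G ` S \<subseteq> carrier G" using S by auto
  ultimately show ?case
    using foldr_mult_append[of us vs] by (intro exI[of _ "us @ vs"]) auto
qed

lemma shortest_word:
  assumes S: "S \<subseteq> carrier G" "generate G S = carrier G" and x: "x \<in> carrier G"
  obtains ws where "set ws \<subseteq> S \<union> m_inv G ` S" "foldr (\<otimes>) ws \<one> = x"
    "length ws = word_length G (S \<union> m_inv G ` S) x"
proof -
  have "\<exists>n ws. set ws \<subseteq> S \<union> m_inv G ` S \<and> length ws = n \<and> foldr (\<otimes>) ws \<one> = x"
    using generate_is_word[OF S(1), of x] S(2) x by auto
  from LeastI_ex[OF this] that show thesis unfolding word_length_def by blast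
qed

text \<open>
  A word that spells \<open>x\<close> with the least number of letters is cut anywhere into two pieces that
  are themselves shortest, because a shorter spelling of a piece would give one of \<open>x\<close>.
\<close>
lemma geodesic_length_word_length:
  assumes fin: "finite S" and S: "S \<subseteq> carrier G" "generate G S = carrier G"
  shows "geodesic_length G (word_length G (S \<union> m_inv G ` S))"
proof -
  let ?T = "S \<union> m_inv G ` S"
  let ?len = "word_length G ?T"
  have T: "?T \<subseteq> carrier G" using S(1) by auto
  have sub: "?len (x \<otimes> y) \<le> ?len x + ?len y" if xy: "x \<in> carrier G" "y \<in> carrier G" for x y
  proof -
    obtain us where us: "set us \<subseteq> ?T" "foldr (\<otimes>) us \<one> = x" "length us = ?len x"
      using shortest_word[OF S xy(1)] .
    obtain vs where vs: "set vs \<subseteq> ?T" "foldr (\<otimes>) vs \<one> = y" "length vs = ?len y"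
      using shortest_word[OF S xy(2)] .
    have "foldr (\<otimes>) (us @ vs) \<one> = x \<otimes> y"
      using foldr_mult_append[of us vs] us vs T by blast
    then show ?thesis using word_length_le[of "us @ vs" ?T] us vs by simp
  qed
  show ?thesis
  proof unfold_locales
    fix r
    have "{x \<in> carrier G. ?len x \<le> r} \<subseteq> (\<lambda>ws. foldr (\<otimes>) ws \<one>) ` {ws. set ws \<subseteq> ?T \<and> length ws \<le> r}"
    proof
      fix x assume x: "x \<in> {x \<in> carrier G. ?len x \<le> r}"
      then obtain ws where "set ws \<subseteq> ?T" "foldr (\<otimes>) ws \<one> = x" "length ws = ?len x"
        using shortest_word[OF S, of x] by blast
      with x show "x \<in> (\<lambda>ws. foldr (\<otimes>) ws \<one>) ` {ws. set ws \<subseteq> ?T \<and> length ws \<le> r}" by force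
    qed
    moreover have "finite {ws. set ws \<subseteq> ?T \<and> length ws \<le> r}"
      using fin by (intro finite_lists_length_le) simp
    ultimately show "finite {x \<in> carrier G. ?len x \<le> r}" by (rule finite_surj[rotated])
  next
    show "?len \<one> = 0" using word_length_le[of "[]" ?T \<one>] by simp
  next
    fix x assume x: "x \<in> carrier G" "?len x = 0"
    then obtain ws where "foldr (\<otimes>) ws \<one> = x" "length ws = ?len x"
      using shortest_word[OF S, of x] by blast
    then show "x = \<one>" using x(2) by simp
  next
    fix x y assume "x \<in> carrier G" "y \<in> carrier G"
    then show "?len (x \<otimes> y) \<le> ?len x + ?len y" by (rule sub)
  next
    fix x k assume x: "x \<in> carrier G" and k: "k \<le> ?len x"
    obtain ws where ws: "set ws \<subseteq> ?T" "foldr (\<otimes>) ws \<one> = x" "length ws = ?len x"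
      using shortest_word[OF S x] .
    define y z where "y = foldr (\<otimes>) (take k ws) \<one>" and "z = foldr (\<otimes>) (drop k ws) \<one>"
    have parts: "set (take k ws) \<subseteq> ?T" "set (drop k ws) \<subseteq> ?T"
      using ws(1) set_take_subset[of k ws] set_drop_subset[of k ws] by blast+
    then have yz: "y \<in> carrier G" "z \<in> carrier G"
      unfolding y_def z_def using T by (meson foldr_mult_closed order_trans)+
    have x_eq: "x = y \<otimes> z"
      using foldr_mult_append[of "take k ws" "drop k ws"] parts T ws(2)
      unfolding y_def z_def append_take_drop_id by (metis order_trans)
    have "?len y \<le> k" "?len z \<le> ?len x - k"
      using word_length_le[OF parts(1) y_def[symmetric]] word_length_le[OF parts(2) z_def[symmetric]]
        ws(3) k by auto
    moreover have "?len x \<le> ?len y + ?len z" using sub[OF yz] x_eq by simp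
    ultimately have "?len y = k" "?len z = ?len x - k" using k by auto
    then show "\<exists>y\<in>carrier G. \<exists>z\<in>carrier G. x = y \<otimes> z \<and> ?len y = k \<and> ?len z = ?len x - k"
      using yz x_eq by blast
  qed
qed

lemma verts_cayley_graph: "verts (cayley_graph G S) = carrier G"
  by (simp add: cayley_graph_def)

lemma cayley_walk_of_word:
  assumes "S \<subseteq> carrier G" "set ws \<subseteq> S \<union> m_inv G ` S" "u \<in> carrier G"
  shows "\<exists>p. pre_digraph.awalk (cayley_graph G S) u p (u \<otimes> foldr (\<otimes>) ws \<one>) \<and> length p = length ws"
proof -
  interpret C: wf_digraph "cayley_graph G S" by (rule wf_digraph_cayley_graph)
  show ?thesis
    using assms(2,3)
  proof (induction ws arbitrary: u)
    case Nil
    then show ?case by (auto simp: C.awalk_Nil_iff verts_cayley_graph)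
  next
    case (Cons w ws)
    have w: "w \<in> S \<union> m_inv G ` S" "w \<in> carrier G" and ws: "set ws \<subseteq> S \<union> m_inv G ` S"
      using Cons.prems assms(1) by auto
    have ws_closed: "foldr (\<otimes>) ws \<one> \<in> carrier G"
      using ws assms(1) by (intro foldr_mult_closed) auto
    have "u \<otimes> w \<in> carrier G" using Cons.prems w by simp
    then obtain p where p: "C.awalk (u \<otimes> w) p ((u \<otimes> w) \<otimes> foldr (\<otimes>) ws \<one>)" "length p = length ws"
      using Cons.IH[OF ws] by blast
    have "\<exists>s\<in>S. u \<otimes> w = u \<otimes> s \<or> u = (u \<otimes> w) \<otimes> s"
    proof (cases "w \<in> S")
      case False
      then obtain s where s: "s \<in> S" "w = inv s" using w by blast
      then have "u = (u \<otimes> w) \<otimes> s" using Cons.prems assms(1) by (auto simp: m_assoc subset_iff)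
      then show ?thesis using s by blast
    qed blast
    then have "(u, u \<otimes> w) \<in> arcs (cayley_graph G S)"
      using \<open>u \<otimes> w \<in> carrier G\<close> Cons.prems by (simp add: cayley_graph_def)
    then have "C.awalk u ((u, u \<otimes> w) # p) (u \<otimes> foldr (\<otimes>) (w # ws) \<one>)"
      using p(1) Cons.prems w ws_closed
      by (simp add: C.awalk_Cons_iff m_assoc) (simp add: cayley_graph_def)
    then show ?case using p(2) by (metis length_Cons)
  qed
qed

text \<open>
  Left translation carries word-length balls into balls of the Cayley graph about any vertex, so
  a growth bound at one vertex bounds the word-length balls.
\<close>
lemma card_word_ball_le:
  assumes S: "S \<subseteq> carrier G" "generate G S = carrier G" and u: "u \<in> carrier G"
    and fin: "finite (wf_digraph.graph_ball (cayley_graph G S) u r)"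
  shows "card {x \<in> carrier G. word_length G (S \<union> m_inv G ` S) x \<le> r}
    \<le> card (wf_digraph.graph_ball (cayley_graph G S) u r)"
proof (rule card_inj_on_le[OF _ _ fin])
  interpret C: wf_digraph "cayley_graph G S" by (rule wf_digraph_cayley_graph)
  show "inj_on ((\<otimes>) u) {x \<in> carrier G. word_length G (S \<union> m_inv G ` S) x \<le> r}"
    using u by (auto simp: inj_on_def)
  show "(\<otimes>) u ` {x \<in> carrier G. word_length G (S \<union> m_inv G ` S) x \<le> r} \<subseteq> C.graph_ball u r"
  proof clarify
    fix x assume x: "x \<in> carrier G" and le: "word_length G (S \<union> m_inv G ` S) x \<le> r"
    obtain ws where ws: "set ws \<subseteq> S \<union> m_inv G ` S" "foldr (\<otimes>) ws \<one> = x"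
        "length ws = word_length G (S \<union> m_inv G ` S) x"
      using shortest_word[OF S x] .
    obtain p where "C.awalk u p (u \<otimes> x)" "length p = length ws"
      using cayley_walk_of_word[OF S(1) ws(1) u] ws(2) by auto
    then have "C.graph_dist u (u \<otimes> x) \<le> ereal (real r)"
      using le ws(3) by (auto simp: C.graph_dist_le_iff)
    then show "u \<otimes> x \<in> C.graph_ball u r"
      using u x by (simp add: C.graph_ball_def verts_cayley_graph)
  qed
qed

end

section \<open>Groups of linear growth are virtually cyclic\<close>

theorem theorem1p2:
  fixes G :: "('a, 'b) monoid_scheme"
  assumes "group G"
    and "finitely_generated_group G"
    and "infinite (carrier G)"
    and "group_linear_volume_growth G"
  shows "\<exists>H. subgroup H G \<and> cyclic_group (G\<lparr>carrier := H\<rparr>) \<and> finite (rcosets\<^bsub>G\<^esub> H)"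
proof -
  interpret group G by fact
  obtain S where S: "finite S" "S \<subseteq> carrier G" "generate G S = carrier G"
    and lin: "wf_digraph.linear_volume_growth (cayley_graph G S)"
    using assms(4) by (auto simp: group_linear_volume_growth_def finite_generating_set_def)
  interpret C: wf_digraph "cayley_graph G S" by (rule wf_digraph_cayley_graph)
  obtain u and C :: real where u: "u \<in> carrier G"
    and ball: "\<And>r. r \<ge> 1 \<Longrightarrow> finite (C.graph_ball u r) \<and> real (card (C.graph_ball u r)) \<le> C * real r"
    using lin by (auto simp: C.linear_volume_growth_def verts_cayley_graph)
  let ?len = "word_length G (S \<union> m_inv G ` S)"
  interpret geodesic_length G ?len using S by (rule geodesic_length_word_length)
  have growth: "real (card {x \<in> carrier G. ?len x \<le> r}) \<le> C * real r" if "r \<ge> 1" for r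
    using card_word_ball_le[OF S(2,3) u, of r] ball[OF that] by linarith
  obtain g where g: "g \<in> carrier G" "inj (\<lambda>k::nat. g [^]\<^bsub>G\<^esub> k)"
    using exists_infinite_order[OF assms(3) growth] by blast
  have "subgroup_generated G {g} = G\<lparr>carrier := generate G {g}\<rparr>"
    using g(1) by (simp add: subgroup_generated_def)
  then have "cyclic_group (G\<lparr>carrier := generate G {g}\<rparr>)"
    using cyclic_group_generated[of g] by simp
  moreover have "subgroup (generate G {g}) G" using g(1) generate_is_subgroup by simp
  moreover have "finite (rcosets\<^bsub>G\<^esub> (generate G {g}))"
    using finite_index_of_infinite_order[OF growth g] .
  ultimately show ?thesis by blast
qed

end
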